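(* Let $n$ be a positive integer, let $g_1,\dots,g_n\in H^2(\mathbb{D})$, and let $A$ be the finite rank operator on $H^2(\mathbb{D})$ given by $A(f)=\sum_{i=1}^{n}\langle f,g_i\rangle g_i$ for $f\in H^2(\mathbb{D})$. Then the Berezin range $\mathrm{Ber}(A)$ is convex in $\mathbb{C}$.
   Context: $\mathbb{D}$ is the open unit disc in $\mathbb{C}$. $H^2(\mathbb{D})$ is the Hardy space of holomorphic functions $f(z)=\sum_{n\ge 0}a_nz^n$ on $\mathbb{D}$ with $\sum_{n\ge0}|a_n|^2<\infty$, with inner product $\langle f,g\rangle=\sum_{n\ge0}a_n\overline{b_n}$ for $g(z)=\sum_{n\ge 0} b_nz^n$. It is a reproducing kernel Hilbert space with reproducing kernel $k_\lambda(z)=\frac{1}{1-\bar\lambda z}$ at $\lambda\in\mathbb{D}$, and $\hat{k}_\lambda=k_\lambda/\|k_\lambda\|$ is the normalized reproducing kernel. For a bounded linear operator $T$ on $H^2(\mathbb{D})$, the Berezin transform is $\widetilde{T}(\lambda)=\langle T\hat{k}_\lambda,\hat{k}_\lambda\rangle$ for $\lambda\in\mathbb{D}$, and the Berezin range is $\mathrm{Ber}(T)=\{\widetilde{T}(\lambda):\lambda\in\mathbb{D}\}$. *)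

theory Defs
  imports "HOL-Complex_Analysis.Complex_Analysis"
begin

text \<open>
  Elements of the Hardy space are represented by total functions on \<open>\<complex>\<close> that are holomorphic
  on the open unit disc. Their values off the disc are irrelevant: two functions agreeing on
  the disc represent the same element, and membership and inner product depend only on the
  values on the disc. An operator is accordingly a map \<open>T\<close> whose results \<open>T f z\<close> matter only
  for \<open>f\<close> in the space and \<open>z\<close> in the disc.
\<close>

abbreviation unit_disc :: "complex set" where
  "unit_disc \<equiv> ball 0 1"

definition taylor_coeff :: "(complex \<Rightarrow> complex) \<Rightarrow> nat \<Rightarrow> complex" where
  "taylor_coeff f n = fps_nth (fps_expansion f 0) n"

definition hardy_space :: "(complex \<Rightarrow> complex) set" where
  "hardy_space =
     {f. f holomorphic_on unit_disc \<and> summable (\<lambda>n. (cmod (taylor_coeff f n))\<^sup>2)}"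

definition hardy_inner :: "(complex \<Rightarrow> complex) \<Rightarrow> (complex \<Rightarrow> complex) \<Rightarrow> complex" where
  "hardy_inner f g = (\<Sum>n. taylor_coeff f n * cnj (taylor_coeff g n))"

definition hardy_norm :: "(complex \<Rightarrow> complex) \<Rightarrow> real" where
  "hardy_norm f = sqrt (Re (hardy_inner f f))"

definition hardy_kernel :: "complex \<Rightarrow> complex \<Rightarrow> complex" where
  "hardy_kernel w z = 1 / (1 - cnj w * z)"

definition normalized_kernel :: "complex \<Rightarrow> complex \<Rightarrow> complex" where
  "normalized_kernel w z = hardy_kernel w z / complex_of_real (hardy_norm (hardy_kernel w))"

definition berezin_transform ::
    "((complex \<Rightarrow> complex) \<Rightarrow> complex \<Rightarrow> complex) \<Rightarrow> complex \<Rightarrow> complex" where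
  "berezin_transform T w = hardy_inner (T (normalized_kernel w)) (normalized_kernel w)"

definition berezin_range ::
    "((complex \<Rightarrow> complex) \<Rightarrow> complex \<Rightarrow> complex) \<Rightarrow> complex set" where
  "berezin_range T = berezin_transform T ` unit_disc"

end

theory Submission imports Defs begin

text \<open>
  The reproducing property \<open>\<langle>f, k\<^sub>w\<rangle> = f w\<close> turns the Berezin transform of \<open>A\<close> into
  \<open>(1 - \<bar>w\<bar>\<^sup>2) * (\<Sum>i. \<bar>g\<^sub>i w\<bar>\<^sup>2)\<close>: one factor \<open>g\<^sub>i w\<close> is the inner product with the
  kernel, the other one is the conjugate inner product inside \<open>A\<close>, and the weight is
  \<open>1 / \<parallel>k\<^sub>w\<parallel>\<^sup>2\<close>. So the transform is a continuous real-valued function on the disc. The disc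
  is connected, and a connected set of reals is an interval; hence the Berezin range is an
  interval of the real axis and therefore convex in \<open>\<complex>\<close>.

  The reproducing property itself is only the statement that the Taylor series of \<open>f\<close>
  converges to \<open>f\<close> on the disc, because the Taylor coefficients of \<open>k\<^sub>w\<close> are the powers of
  the conjugate of \<open>w\<close>.
\<close>

lemma taylor_series_sums:
  assumes "f holomorphic_on unit_disc" "w \<in> unit_disc"
  shows "(\<lambda>n. taylor_coeff f n * w ^ n) sums f w"
  using holomorphic_power_series[OF assms] by (simp add: taylor_coeff_def fps_expansion_def)

lemma taylor_coeff_eqI:
  assumes "\<And>z. z \<in> unit_disc \<Longrightarrow> (\<lambda>n. a n * z ^ n) sums f z"
  shows "taylor_coeff f n = a n"
proof -
  have "eventually (\<lambda>z. z \<in> unit_disc) (nhds (0::complex))"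
    by (rule eventually_nhds_in_open) auto
  hence "f has_fps_expansion Abs_fps a"
    by (intro has_fps_expansionI) (elim eventually_mono, simp only: fps_nth_Abs_fps assms)
  thus ?thesis
    by (simp add: taylor_coeff_def fps_expansion_eqI)
qed

lemma cmod_cnj_mult_less_1:
  assumes "w \<in> unit_disc" "z \<in> unit_disc"
  shows "cmod (cnj w * z) < 1"
proof -
  have "cmod w * cmod z \<le> cmod w * 1"
    using assms by (intro mult_left_mono) auto
  thus ?thesis using assms by (simp add: norm_mult)
qed

text \<open>
  The constant divisor \<open>c\<close> lets the same computation serve the kernel (\<open>c = 1\<close>), from which
  its norm is obtained, and then the normalized kernel.
\<close>

lemma taylor_coeff_kernel_div:
  assumes "w \<in> unit_disc"
  shows "taylor_coeff (\<lambda>z. hardy_kernel w z / c) n = cnj w ^ n / c"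
proof (rule taylor_coeff_eqI)
  fix z :: complex assume "z \<in> unit_disc"
  then have "(\<lambda>n. (cnj w * z) ^ n) sums (1 / (1 - cnj w * z))"
    using cmod_cnj_mult_less_1[OF assms] by (intro geometric_sums) auto
  from sums_divide[OF this, of c]
  show "(\<lambda>n. cnj w ^ n / c * z ^ n) sums (hardy_kernel w z / c)"
    by (simp add: hardy_kernel_def power_mult_distrib)
qed

lemma kernel_div_holomorphic:
  assumes "w \<in> unit_disc"
  shows "(\<lambda>z. hardy_kernel w z / c) holomorphic_on unit_disc"
proof -
  have "1 - cnj w * z \<noteq> 0" if "z \<in> unit_disc" for z
    using cmod_cnj_mult_less_1[OF assms that] by auto
  thus ?thesis
    unfolding hardy_kernel_def divide_inverse by (intro holomorphic_intros) auto
qed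

lemma hardy_inner_kernel_div_sums:
  assumes "f holomorphic_on unit_disc" "w \<in> unit_disc"
  shows "(\<lambda>n. taylor_coeff f n * cnj (taylor_coeff (\<lambda>z. hardy_kernel w z / c) n))
           sums (f w / cnj c)"
  using sums_divide[OF taylor_series_sums[OF assms], of "cnj c"]
  by (simp add: taylor_coeff_kernel_div[OF assms(2)])

lemma hardy_inner_kernel_div_right:
  assumes "f holomorphic_on unit_disc" "w \<in> unit_disc"
  shows "hardy_inner f (\<lambda>z. hardy_kernel w z / c) = f w / cnj c"
  unfolding hardy_inner_def using hardy_inner_kernel_div_sums[OF assms]
  by (rule sums_unique[symmetric])

lemma hardy_inner_kernel_div_left:
  assumes "f holomorphic_on unit_disc" "w \<in> unit_disc"
  shows "hardy_inner (\<lambda>z. hardy_kernel w z / c) f = cnj (f w) / c"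
proof -
  have "(\<lambda>n. taylor_coeff (\<lambda>z. hardy_kernel w z / c) n * cnj (taylor_coeff f n))
          sums (cnj (f w) / c)"
    using sums_cnj[THEN iffD2, OF hardy_inner_kernel_div_sums[OF assms, of c]]
    by (simp add: mult.commute)
  thus ?thesis unfolding hardy_inner_def by (rule sums_unique[symmetric])
qed

lemma hardy_norm_kernel:
  assumes "w \<in> unit_disc"
  shows "hardy_norm (hardy_kernel w) = 1 / sqrt (1 - (cmod w)\<^sup>2)"
proof -
  have "hardy_inner (hardy_kernel w) (hardy_kernel w) = hardy_kernel w w"
    using hardy_inner_kernel_div_right[OF kernel_div_holomorphic[OF assms, of 1] assms, of 1]
    by simp
  also have "\<dots> = complex_of_real (1 / (1 - (cmod w)\<^sup>2))"
    by (simp add: hardy_kernel_def mult.commute[of "cnj w"] complex_norm_square del: of_real_power)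
  finally show ?thesis
    unfolding hardy_norm_def by (simp only: Re_complex_of_real real_sqrt_divide real_sqrt_one)
qed

lemma normalized_kernel_in_hardy_space:
  assumes "w \<in> unit_disc"
  shows "normalized_kernel w \<in> hardy_space"
proof -
  define c where "c = complex_of_real (hardy_norm (hardy_kernel w))"
  have eq: "normalized_kernel w = (\<lambda>z. hardy_kernel w z / c)"
    by (simp add: fun_eq_iff normalized_kernel_def c_def)
  have "(cmod w)\<^sup>2 < 1"
    using assms by (simp add: abs_square_less_1)
  hence "summable (\<lambda>n. ((cmod w)\<^sup>2) ^ n / (cmod c)\<^sup>2)"
    by (intro summable_divide summable_geometric) simp
  also have "(\<lambda>n. ((cmod w)\<^sup>2) ^ n / (cmod c)\<^sup>2) =
             (\<lambda>n. (cmod (taylor_coeff (normalized_kernel w) n))\<^sup>2)"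
    unfolding eq taylor_coeff_kernel_div[OF assms]
    by (simp add: norm_divide norm_power power_divide mult.commute flip: power_mult)
  finally show ?thesis
    using kernel_div_holomorphic[OF assms, of c] by (simp add: hardy_space_def eq)
qed

text \<open>
  The reproducing property enters twice. Applied inside \<open>A\<close>, with the kernel as first
  argument, it yields the conjugate of \<open>g\<^sub>i w\<close>; applied to the outer inner product, it evaluates
  \<open>A\<close> at \<open>w\<close> and yields \<open>g\<^sub>i w\<close>. Each application contributes one factor \<open>1 / \<parallel>k\<^sub>w\<parallel>\<close>.
\<close>

lemma berezin_transform_sum_rank_one:
  assumes g: "\<And>i. i \<in> I \<Longrightarrow> g i \<in> hardy_space"
    and A: "\<And>f z. f \<in> hardy_space \<Longrightarrow> z \<in> unit_disc \<Longrightarrow>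
              A f z = (\<Sum>i\<in>I. hardy_inner f (g i) * g i z)"
    and w: "w \<in> unit_disc"
  shows "berezin_transform A w =
           complex_of_real ((1 - (cmod w)\<^sup>2) * (\<Sum>i\<in>I. (cmod (g i w))\<^sup>2))"
proof -
  define c where "c = complex_of_real (hardy_norm (hardy_kernel w))"
  have eq: "normalized_kernel w = (\<lambda>z. hardy_kernel w z / c)"
    by (simp add: fun_eq_iff normalized_kernel_def c_def)
  have g_hol: "g i holomorphic_on unit_disc" if "i \<in> I" for i
    using g[OF that] by (simp add: hardy_space_def)
  have "(cmod w)\<^sup>2 < 1"
    using w by (simp add: abs_square_less_1)
  hence c2: "c * c = 1 / complex_of_real (1 - (cmod w)\<^sup>2)"
    unfolding c_def hardy_norm_kernel[OF w] by (simp flip: of_real_mult)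
  have A_eq: "A (normalized_kernel w) z = (\<Sum>i\<in>I. cnj (g i w) / c * g i z)"
    if "z \<in> unit_disc" for z
    unfolding A[OF normalized_kernel_in_hardy_space[OF w] that]
    by (intro sum.cong refl) (simp add: eq hardy_inner_kernel_div_left[OF g_hol w])
  have "(\<lambda>z. \<Sum>i\<in>I. cnj (g i w) / c * g i z) holomorphic_on unit_disc"
    by (intro holomorphic_intros g_hol)
  (* A is only prescribed on the disc, so holomorphy passes to its value by agreement there. *)
  hence "A (normalized_kernel w) holomorphic_on unit_disc"
    by (rule holomorphic_transform) (simp add: A_eq)
  hence "berezin_transform A w = A (normalized_kernel w) w / cnj c"
    unfolding berezin_transform_def
    by (subst (2) eq) (rule hardy_inner_kernel_div_right[OF _ w])
  also have "\<dots> = (\<Sum>i\<in>I. g i w * cnj (g i w) / (c * c))"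
    by (simp add: A_eq[OF w] sum_divide_distrib c_def mult.commute)
  also have "\<dots> = complex_of_real ((1 - (cmod w)\<^sup>2) * (\<Sum>i\<in>I. (cmod (g i w))\<^sup>2))"
    unfolding c2 by (simp add: complex_norm_square sum_distrib_left mult.commute del: of_real_power)
  finally show ?thesis .
qed

lemma convex_of_real_image_connected:
  fixes h :: "'a::topological_space \<Rightarrow> real"
  assumes "connected S" "continuous_on S h"
  shows "convex ((\<lambda>x. complex_of_real (h x)) ` S)"
proof -
  have "convex (h ` S)"
    using connected_continuous_image[OF assms(2,1)] by (simp add: connected_convex_1)
  hence "convex (complex_of_real ` h ` S)"
    by (intro convex_linear_image linear_of_real)
  thus ?thesis by (simp add: image_image)
qed

theorem theorem2p6:
  fixes n :: nat
    and g :: "nat \<Rightarrow> complex \<Rightarrow> complex"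
    and A :: "(complex \<Rightarrow> complex) \<Rightarrow> complex \<Rightarrow> complex"
  assumes "n \<ge> 1"
    and "\<And>i. i \<in> {1..n} \<Longrightarrow> g i \<in> hardy_space"
    and "\<And>f z. f \<in> hardy_space \<Longrightarrow> z \<in> unit_disc \<Longrightarrow>
           A f z = (\<Sum>i=1..n. hardy_inner f (g i) * g i z)"
  shows "convex (berezin_range A)"
proof -
  let ?h = "\<lambda>w. (1 - (cmod w)\<^sup>2) * (\<Sum>i=1..n. (cmod (g i w))\<^sup>2)"
  have "continuous_on unit_disc (g i)" if "i \<in> {1..n}" for i
    using assms(2)[OF that] by (auto simp: hardy_space_def intro: holomorphic_on_imp_continuous_on)
  hence "continuous_on unit_disc ?h"
    by (intro continuous_intros)
  hence "convex ((\<lambda>w. complex_of_real (?h w)) ` unit_disc)"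
    by (intro convex_of_real_image_connected) auto
  also have "(\<lambda>w. complex_of_real (?h w)) ` unit_disc = berezin_range A"
    unfolding berezin_range_def
    by (intro image_cong refl berezin_transform_sum_rank_one[symmetric] assms(2,3))
  finally show ?thesis .
qed

end
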